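(* Let $0<\alpha\le 1$, let $p,p_0\in(0,1)$ with $p_0\neq p$, and let $M$ be a random variable with values in $\{0,1,2,\dots\}$ and probability generating function $P(s)$ such that $$\lim_{s\to1^-}\frac{1-P(s)}{(1-s)^\alpha}=\lambda>0.$$ Let $\{Y_j\}$ be a sequence of i.i.d. Bernoulli variables with parameter $b\in(0,1)$, independent of $M$, and put $X=\sum_{j=1}^{M}Y_j$. Let $\{X_i\}$ be a sequence of independent copies of $X$ and $N$ a geometric($p$) variable independent of $\{X_i\}$; let $\{M_i\}$ be a sequence of independent copies of $M$ and $N_0$ a geometric($p_0$) variable independent of $\{M_i\}$. Then $\sum_{i=1}^{N_0}M_i$ and $\sum_{i=1}^{N}X_i$ are identically distributed if and only if $p<p_0$, $b^\alpha=p/p_0$ and $M$ is $\mathrm{DML}(\lambda,\alpha)$.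
   Context: A geometric($p$) variable has probability generating function $ps/(1-qs)$, $q=1-p$. A random variable has a discrete Mittag-Leffler distribution $\mathrm{DML}(\lambda,\alpha)$, $\lambda>0$, $0<\alpha\le1$, if its probability generating function is $[1+\lambda(1-s)^\alpha]^{-1}$. An empty sum is $0$. *)

theory Defs
  imports "HOL-Probability.Probability"
begin

definition pgf :: "'a measure \<Rightarrow> ('a \<Rightarrow> nat) \<Rightarrow> real \<Rightarrow> real" where
  "pgf \<Omega> X s = (\<integral>\<omega>. s ^ X \<omega> \<partial>\<Omega>)"

definition law :: "'a measure \<Rightarrow> ('a \<Rightarrow> nat) \<Rightarrow> nat measure" where
  "law \<Omega> X = distr \<Omega> (count_space UNIV) X"

text \<open>
  Probability generating functions are compared on \<open>[0,1]\<close>, where they determine the law.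
  This geometric distribution lives on \<open>{1, 2, \<dots>}\<close>, so it is \<^const>\<open>geometric_pmf\<close>
  shifted by one.
\<close>

definition geometric_rv :: "'a measure \<Rightarrow> real \<Rightarrow> ('a \<Rightarrow> nat) \<Rightarrow> bool" where
  "geometric_rv \<Omega> p N \<longleftrightarrow> N \<in> \<Omega> \<rightarrow>\<^sub>M count_space UNIV \<and>
     (\<forall>s\<in>{0..1}. pgf \<Omega> N s = p * s / (1 - (1 - p) * s))"

definition DML_rv :: "'a measure \<Rightarrow> real \<Rightarrow> real \<Rightarrow> ('a \<Rightarrow> nat) \<Rightarrow> bool" where
  "DML_rv \<Omega> lam \<alpha> M \<longleftrightarrow> 0 < lam \<and> 0 < \<alpha> \<and> \<alpha> \<le> 1 \<and> M \<in> \<Omega> \<rightarrow>\<^sub>M count_space UNIV \<and>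
     (\<forall>s\<in>{0..1}. pgf \<Omega> M s = inverse (1 + lam * (1 - s) powr \<alpha>))"

definition bernoulli_rv :: "'a measure \<Rightarrow> real \<Rightarrow> ('a \<Rightarrow> nat) \<Rightarrow> bool" where
  "bernoulli_rv \<Omega> b Y \<longleftrightarrow> Y \<in> \<Omega> \<rightarrow>\<^sub>M count_space UNIV \<and>
     law \<Omega> Y = measure_pmf (map_pmf of_bool (bernoulli_pmf b))"

text \<open>
  Sequences are indexed by \<open>i \<ge> 1\<close>; the value at index \<open>0\<close> is irrelevant.
\<close>

definition indep_seq :: "'a measure \<Rightarrow> (nat \<Rightarrow> 'a \<Rightarrow> nat) \<Rightarrow> bool" where
  "indep_seq \<Omega> X \<longleftrightarrow> prob_space.indep_vars \<Omega> (\<lambda>_. count_space UNIV) X {1..}"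

text \<open>
  Independence of \<open>N\<close> from the whole sequence, viewed as one product-space valued variable.
  \<open>indep_var\<close> requires both variables to take values in the same type, so the condition is
  stated for the generated sigma-algebras.
\<close>

definition indep_of_seq :: "'a measure \<Rightarrow> ('a \<Rightarrow> nat) \<Rightarrow> (nat \<Rightarrow> 'a \<Rightarrow> nat) \<Rightarrow> bool" where
  "indep_of_seq \<Omega> N X \<longleftrightarrow>
     N \<in> \<Omega> \<rightarrow>\<^sub>M count_space UNIV \<and> (\<forall>i\<ge>1. X i \<in> \<Omega> \<rightarrow>\<^sub>M count_space UNIV) \<and>
     prob_space.indep_set \<Omega>
       (sets (vimage_algebra (space \<Omega>) N (count_space UNIV)))
       (sets (vimage_algebra (space \<Omega>) (\<lambda>\<omega>. \<lambda>i\<in>{1..}. X i \<omega>)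
         (Pi\<^sub>M {1..} (\<lambda>_. count_space UNIV))))"

definition indep_copies :: "'a measure \<Rightarrow> ('a \<Rightarrow> nat) \<Rightarrow> (nat \<Rightarrow> 'a \<Rightarrow> nat) \<Rightarrow> bool" where
  "indep_copies \<Omega> Z X \<longleftrightarrow> indep_seq \<Omega> X \<and> (\<forall>i\<ge>1. law \<Omega> (X i) = law \<Omega> Z)"

definition random_sum :: "('a \<Rightarrow> nat) \<Rightarrow> (nat \<Rightarrow> 'a \<Rightarrow> nat) \<Rightarrow> 'a \<Rightarrow> nat" where
  "random_sum N X \<omega> = (\<Sum>i=1..N \<omega>. X i \<omega>)"

end

(* Write A(t) = 1 / P(1 - t) - 1. Conditioning on the number of summands, the two random sums have
   the same probability generating function exactly when A(b t) = (p / p0) A(t) for 0 < t <= 1.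
   Iterating this relation along b^n t and comparing with A(t) ~ lam t^alpha as t tends to 0 forces
   p / p0 = b^alpha and A(t) = lam t^alpha. *)
theory Submission
  imports Defs "HOL-Complex_Analysis.Cauchy_Integral_Formula"
begin

section \<open>Rigidity of a scaling equation with prescribed power asymptotics\<close>

text \<open>After division by \<open>t powr \<alpha>\<close>, each rescaling of \<open>t\<close> by
  \<open>b\<close> multiplies the quotient by the fixed number
  \<open>r = c / b powr \<alpha>\<close>. Along \<open>b ^ n * t\<close> the quotient is therefore
  geometric in \<open>n\<close>, while the asymptotics make it converge to \<open>l\<close>. A
  nonzero limit allows only \<open>r = 1\<close>, and then the quotient equals its limit.\<close>

lemma scaling_equation_solution:
  fixes a :: "real \<Rightarrow> real"
  assumes b: "0 < b" "b < 1"
    and scale: "\<And>t. 0 < t \<Longrightarrow> t \<le> 1 \<Longrightarrow> a (b * t) = c * a t"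
    and lim: "((\<lambda>t. a t / t powr \<alpha>) \<longlongrightarrow> l) (at_right 0)"
    and "l \<noteq> 0"
  shows "c = b powr \<alpha> \<and> (\<forall>t. 0 < t \<longrightarrow> t \<le> 1 \<longrightarrow> a t = l * t powr \<alpha>)"
proof -
  define r where "r = c / b powr \<alpha>"
  define g where "g t = a t / t powr \<alpha>" for t
  have step: "g (b * t) = r * g t" if "0 < t" "t \<le> 1" for t
    using scale[OF that] that b by (simp add: g_def r_def powr_mult)
  have in_unit: "0 < b ^ n * t \<and> b ^ n * t \<le> 1" if "0 < t" "t \<le> 1" for n t
    using that b mult_mono[of "b ^ n" 1 t 1] by (auto simp: power_le_one)
  have iter: "g (b ^ n * t) = r ^ n * g t" if "0 < t" "t \<le> 1" for n t
  proof (induction n)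
    case (Suc n)
    then show ?case
      using step[of "b ^ n * t"] in_unit[OF that, of n] by (simp add: mult.assoc)
  qed simp
  have conv: "(\<lambda>n. r ^ n * g t) \<longlonglongrightarrow> l" if t: "0 < t" "t \<le> 1" for t
  proof -
    have "(\<lambda>n. b ^ n) \<longlonglongrightarrow> 0"
      using b by (intro LIMSEQ_realpow_zero) auto
    then have "(\<lambda>n. b ^ n * t) \<longlonglongrightarrow> 0"
      by (rule tendsto_mult_left_zero)
    then have "filterlim (\<lambda>n. b ^ n * t) (at_right 0) sequentially"
      using in_unit[OF t] t b by (auto simp: filterlim_at)
    from filterlim_compose[OF lim this] show ?thesis
      unfolding iter[OF t, symmetric] by (simp add: g_def)
  qed
  \<comment> \<open>One sequence is read in two ways: as \<open>r\<close> times the convergent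
    sequence at \<open>t = 1\<close>, and as its shift by one index.\<close>
  have "(\<lambda>n. r * (r ^ n * g 1)) \<longlonglongrightarrow> r * l"
    by (intro tendsto_intros conv) auto
  moreover have "(\<lambda>n. r ^ Suc n * g 1) \<longlonglongrightarrow> l"
    using conv[of 1] by (subst filterlim_sequentially_Suc) auto
  ultimately have "r * l = l"
    by (intro LIMSEQ_unique[of "\<lambda>n. r ^ Suc n * g 1"]) (simp_all add: mult.assoc)
  then have "r = 1"
    using \<open>l \<noteq> 0\<close> by simp
  moreover have "a t = l * t powr \<alpha>" if "0 < t" "t \<le> 1" for t
    using conv[OF that] \<open>r = 1\<close> that by (simp add: LIMSEQ_const_iff g_def field_simps)
  ultimately show ?thesis
    using b by (auto simp: r_def field_simps)
qed

section \<open>Uniqueness of power series coefficients from one-sided information\<close>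

text \<open>Zeros of a nontrivial power series are isolated, whereas here zeros accumulate at 0 from
  the right. The bound on the coefficients guarantees convergence on the whole interval (-1,
  1).\<close>

lemma powser_coeffs_eq_0:
  fixes a :: "nat \<Rightarrow> real"
  assumes bound: "\<And>n. \<bar>a n\<bar> \<le> 1"
    and zero: "\<And>s. 0 \<le> s \<Longrightarrow> s < 1 \<Longrightarrow> (\<lambda>n. a n * s ^ n) sums 0"
  shows "a n = 0"
proof (rule ccontr)
  assume "a n \<noteq> 0"
  define f where "f s = (\<Sum>n. a n * s ^ n)" for s
  \<comment> \<open>The isolation result asks for a nonzero coefficient of positive index, so the
    constant term is settled first by evaluation at 0.\<close>
  have "(\<lambda>n. a n * 0 ^ n) sums a 0"
    by (rule powser_sums_zero)
  with zero[of 0] have "a 0 = 0"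
    using sums_unique2 by force
  then have "n > 0"
    using \<open>a n \<noteq> 0\<close> by (cases n) auto
  have sums: "(\<lambda>n. a n * (s - 0) ^ n) sums f s" if "norm (s - 0) < 1" for s
  proof -
    have "summable (\<lambda>n. a n * s ^ n)"
    proof (rule summable_comparison_test)
      show "\<exists>N. \<forall>n\<ge>N. norm (a n * s ^ n) \<le> \<bar>s\<bar> ^ n"
        using bound by (auto simp: abs_mult power_abs mult_left_le_one_le)
      show "summable (\<lambda>n. \<bar>s\<bar> ^ n)"
        using that by (intro summable_geometric) auto
    qed
    then show ?thesis
      by (simp add: f_def summable_sums)
  qed
  have f_zero: "f s = 0" if "0 \<le> s" "s < 1" for s
    using zero[OF that] by (simp add: f_def sums_iff)
  obtain d where d: "0 < d" "\<And>z. z \<in> cball 0 d - {0} \<Longrightarrow> f z \<noteq> 0"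
    using powser_0_nonzero[OF zero_less_one sums _ \<open>a n \<noteq> 0\<close> \<open>n > 0\<close>] f_zero[of 0] by auto
  \<comment> \<open>A positive point inside both the zero-free punctured ball and the interval where
    the series vanishes; 1/2 only keeps it below 1.\<close>
  define z where "z = min d (1/2)"
  have "0 < z" "z < 1" "z \<le> d"
    using d(1) by (auto simp: z_def)
  then show False
    using d(2)[of z] f_zero[of z] by auto
qed

section \<open>Generating functions of variables on a probability space\<close>

context prob_space
begin

lemma integrable_power_le_1:
  assumes "Z \<in> M \<rightarrow>\<^sub>M count_space UNIV" "s \<in> {0..1::real}"
  shows "integrable M (\<lambda>\<omega>. s ^ Z \<omega>)"
proof (rule integrable_const_bound[where B = 1])
  show "AE \<omega> in M. norm (s ^ Z \<omega>) \<le> 1"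
    using assms by (auto simp: power_le_one)
  show "(\<lambda>\<omega>. s ^ Z \<omega>) \<in> borel_measurable M"
    by (rule measurable_compose[OF assms(1)]) simp
qed

text \<open>This replaces conditioning on \<open>N\<close>. The partial sums integrate
  \<open>h\<close> over the event \<open>N < m\<close>; since \<open>N\<close> is finite, these
  truncations are eventually equal to \<open>h\<close> at each point, and they are dominated by its
  absolute value.\<close>

lemma integral_sums_fibres:
  fixes h :: "'a \<Rightarrow> real" and N :: "'a \<Rightarrow> nat"
  assumes [measurable]: "N \<in> M \<rightarrow>\<^sub>M count_space UNIV" and h: "integrable M h"
  shows "(\<lambda>n. \<integral>\<omega>. of_bool (N \<omega> = n) * h \<omega> \<partial>M) sums (\<integral>\<omega>. h \<omega> \<partial>M)"
proof -
  have [measurable]: "h \<in> borel_measurable M"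
    using h by simp
  have int: "integrable M (\<lambda>\<omega>. of_bool (N \<omega> = n) * h \<omega>)" for n
    by (rule Bochner_Integration.integrable_bound[OF h]) (auto simp: of_bool_def)
  have partial: "(\<Sum>n<m. of_bool (N \<omega> = n) * h \<omega>) = of_bool (N \<omega> < m) * h \<omega>" for m \<omega>
    by (simp add: of_bool_def if_distrib[where f = "\<lambda>x. x * _"] sum.delta cong: if_cong)
  have "(\<lambda>m. \<integral>\<omega>. of_bool (N \<omega> < m) * h \<omega> \<partial>M) \<longlonglongrightarrow> (\<integral>\<omega>. h \<omega> \<partial>M)"
  proof (rule integral_dominated_convergence[where w = "\<lambda>\<omega>. \<bar>h \<omega>\<bar>"])
    show "AE \<omega> in M. (\<lambda>m. of_bool (N \<omega> < m) * h \<omega>) \<longlonglongrightarrow> h \<omega>"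
    proof (rule AE_I2)
      fix \<omega>
      have "eventually (\<lambda>m. of_bool (N \<omega> < m) * h \<omega> = h \<omega>) sequentially"
        using eventually_gt_at_top[of "N \<omega>"] by eventually_elim simp
      then show "(\<lambda>m. of_bool (N \<omega> < m) * h \<omega>) \<longlonglongrightarrow> h \<omega>"
        by (rule tendsto_eventually)
    qed
  qed (use h in auto)
  moreover have "(\<Sum>n<m. \<integral>\<omega>. of_bool (N \<omega> = n) * h \<omega> \<partial>M) = (\<integral>\<omega>. of_bool (N \<omega> < m) * h \<omega> \<partial>M)" for m
    unfolding partial[symmetric] by (rule Bochner_Integration.integral_sum[symmetric]) (rule int)
  ultimately show ?thesis
    by (simp add: sums_def)
qed

lemma pgf_sums:
  assumes Z[measurable]: "Z \<in> M \<rightarrow>\<^sub>M count_space UNIV" and s: "s \<in> {0..1}"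
  shows "(\<lambda>n. prob {\<omega> \<in> space M. Z \<omega> = n} * s ^ n) sums pgf M Z s"
proof -
  have "(\<integral>\<omega>. of_bool (Z \<omega> = n) * s ^ Z \<omega> \<partial>M) = prob {\<omega> \<in> space M. Z \<omega> = n} * s ^ n" for n
  proof -
    have "(\<integral>\<omega>. of_bool (Z \<omega> = n) * s ^ Z \<omega> \<partial>M)
        = (\<integral>\<omega>. indicator {\<omega> \<in> space M. Z \<omega> = n} \<omega> * s ^ n \<partial>M)"
      by (rule Bochner_Integration.integral_cong) (auto simp: indicator_def)
    also have "\<dots> = prob {\<omega> \<in> space M. Z \<omega> = n} * s ^ n"
      by simp
    finally show ?thesis .
  qed
  with integral_sums_fibres[OF Z integrable_power_le_1[OF Z s]] show ?thesis
    by (simp add: pgf_def)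
qed

lemma pgf_nonneg_le_1:
  assumes "Z \<in> M \<rightarrow>\<^sub>M count_space UNIV" "s \<in> {0..1}"
  shows "pgf M Z s \<in> {0..1}"
proof -
  have "(\<integral>\<omega>. s ^ Z \<omega> \<partial>M) \<le> (\<integral>\<omega>. 1 \<partial>M)"
    using assms by (intro integral_mono integrable_power_le_1) (auto simp: power_le_one)
  then show ?thesis
    using assms by (auto simp: pgf_def prob_space)
qed

text \<open>The point \<open>s = 0\<close> is excluded because the value there is the probability
  that \<open>Z\<close> is 0, which may vanish.\<close>

lemma pgf_pos:
  assumes "Z \<in> M \<rightarrow>\<^sub>M count_space UNIV" "0 < s" "s \<le> 1"
  shows "0 < pgf M Z s"
  unfolding pgf_def using assms by (intro expectation_greater integrable_power_le_1) auto

lemma pgf_at_1: "pgf M Z 1 = 1"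
  by (simp add: pgf_def prob_space)

lemma pgf_cong_law:
  assumes [measurable]: "Z \<in> M \<rightarrow>\<^sub>M count_space UNIV" "Z' \<in> M \<rightarrow>\<^sub>M count_space UNIV"
    and "law M Z = law M Z'"
  shows "pgf M Z s = pgf M Z' s"
proof -
  have "pgf M W s = (\<integral>n. s ^ n \<partial>law M W)" if [measurable]: "W \<in> M \<rightarrow>\<^sub>M count_space UNIV" for W
    unfolding pgf_def law_def by (subst integral_distr) auto
  then show ?thesis
    using assms by metis
qed

text \<open>The differences of the point probabilities are the coefficients of a power series
  vanishing on [0, 1), hence all zero, and a law on a countable set is determined by its point
  masses.\<close>

lemma law_eq_iff_pgf_eq:
  assumes Z[measurable]: "Z \<in> M \<rightarrow>\<^sub>M count_space UNIV" "Z' \<in> M \<rightarrow>\<^sub>M count_space UNIV"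
  shows "law M Z = law M Z' \<longleftrightarrow> (\<forall>s. 0 \<le> s \<longrightarrow> s < 1 \<longrightarrow> pgf M Z s = pgf M Z' s)"
proof
  assume "law M Z = law M Z'"
  then show "\<forall>s. 0 \<le> s \<longrightarrow> s < 1 \<longrightarrow> pgf M Z s = pgf M Z' s"
    using pgf_cong_law[OF Z] by blast
next
  assume eq: "\<forall>s. 0 \<le> s \<longrightarrow> s < 1 \<longrightarrow> pgf M Z s = pgf M Z' s"
  have probs: "prob {\<omega> \<in> space M. Z \<omega> = n} - prob {\<omega> \<in> space M. Z' \<omega> = n} = 0" for n
  proof (rule powser_coeffs_eq_0)
    show "\<bar>prob {\<omega> \<in> space M. Z \<omega> = n} - prob {\<omega> \<in> space M. Z' \<omega> = n}\<bar> \<le> 1" for n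
      using prob_le_1[of "{\<omega> \<in> space M. Z \<omega> = n}"] prob_le_1[of "{\<omega> \<in> space M. Z' \<omega> = n}"]
      by (smt (verit) measure_nonneg)
    fix s :: real assume s: "0 \<le> s" "s < 1"
    show "(\<lambda>n. (prob {\<omega> \<in> space M. Z \<omega> = n} - prob {\<omega> \<in> space M. Z' \<omega> = n}) * s ^ n) sums 0"
      using sums_diff[OF pgf_sums[OF Z(1), of s] pgf_sums[OF Z(2), of s]] s eq
      by (simp add: algebra_simps)
  qed
  show "law M Z = law M Z'"
    unfolding law_def
  proof (rule measure_eqI_countable[where A = UNIV])
    fix n
    show "emeasure (distr M (count_space UNIV) Z) {n} = emeasure (distr M (count_space UNIV) Z') {n}"
      using probs[of n] by (simp add: emeasure_distr emeasure_eq_measure vimage_def Int_def conj_commute)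
  qed auto
qed

section \<open>Random sums and composition of generating functions\<close>

lemma measurable_random_sum:
  assumes [measurable]: "N \<in> M \<rightarrow>\<^sub>M count_space UNIV"
    and X: "\<And>i. i \<ge> 1 \<Longrightarrow> X i \<in> M \<rightarrow>\<^sub>M count_space UNIV"
  shows "random_sum N X \<in> M \<rightarrow>\<^sub>M count_space UNIV"
proof -
  have [measurable]: "(\<lambda>\<omega>. \<Sum>i = 1..n. X i \<omega>) \<in> M \<rightarrow>\<^sub>M count_space UNIV" for n
    using X by (intro measurable_sum_nat) auto
  have "(\<lambda>\<omega>. (\<lambda>n \<omega>. \<Sum>i = 1..n. X i \<omega>) (N \<omega>) \<omega>) \<in> M \<rightarrow>\<^sub>M count_space UNIV"
    by (rule measurable_compose_countable) measurable
  then show ?thesis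
    by (simp add: random_sum_def[abs_def])
qed

lemma integral_power_sum_indep:
  assumes indep: "indep_seq M X" and s: "s \<in> {0..1}"
    and pgf: "\<And>i. i \<ge> 1 \<Longrightarrow> pgf M (X i) s = r"
  shows "(\<integral>\<omega>. s ^ (\<Sum>i = 1..n. X i \<omega>) \<partial>M) = r ^ n"
proof -
  have meas: "X i \<in> M \<rightarrow>\<^sub>M count_space UNIV" if "i \<ge> 1" for i
    using indep that by (auto simp: indep_seq_def indep_vars_def)
  have "indep_vars (\<lambda>_. count_space UNIV) X {1..n}"
    using indep by (auto simp: indep_seq_def intro: indep_vars_subset)
  then have "indep_vars (\<lambda>_. borel) (\<lambda>i \<omega>. s ^ X i \<omega>) {1..n}"
    by (rule indep_vars_compose2) simp
  then have "(\<integral>\<omega>. (\<Prod>i = 1..n. s ^ X i \<omega>) \<partial>M) = (\<Prod>i = 1..n. \<integral>\<omega>. s ^ X i \<omega> \<partial>M)"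
    using meas s by (intro indep_vars_lebesgue_integral integrable_power_le_1) auto
  also have "\<dots> = (\<Prod>i = 1..n. r)"
    using pgf by (intro prod.cong) (auto simp: pgf_def)
  finally show ?thesis
    by (simp add: power_sum)
qed

text \<open>The indicator is measurable for the sigma-algebra generated by \<open>N\<close>, and the
  power for the one generated by the sequence. Independence passes to the smaller sigma-algebras
  that these two functions generate, in the form needed to factor an expectation.\<close>

lemma indep_var_partial_sum:
  assumes "indep_of_seq M N X"
  shows "indep_var borel (\<lambda>\<omega>. of_bool (N \<omega> = n) :: real) borel (\<lambda>\<omega>. s ^ (\<Sum>i = 1..n. X i \<omega>) :: real)"
proof -
  let ?P = "Pi\<^sub>M {1::nat..} (\<lambda>_. count_space (UNIV :: nat set))"
  let ?F = "vimage_algebra (space M) N (count_space UNIV)"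
  let ?G = "vimage_algebra (space M) (\<lambda>\<omega>. \<lambda>i\<in>{1..}. X i \<omega>) ?P"
  have [measurable]: "N \<in> M \<rightarrow>\<^sub>M count_space UNIV"
    and X: "\<And>i. i \<ge> 1 \<Longrightarrow> X i \<in> M \<rightarrow>\<^sub>M count_space UNIV"
    and indep: "indep_set (sets ?F) (sets ?G)"
    using assms by (auto simp: indep_of_seq_def)
  have sub: "sigma_sets (space M) {f -` A \<inter> space M |A. A \<in> sets borel} \<subseteq> sets H"
    if "f \<in> borel_measurable H" "space H = space M" for f :: "'a \<Rightarrow> real" and H
  proof -
    have "{f -` A \<inter> space M |A. A \<in> sets borel} \<subseteq> sets H"
      using measurable_sets[OF that(1)] that(2) by auto
    then show ?thesis
      using sets.sigma_sets_subset[of _ H] that(2) by simp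
  qed
  have "(\<lambda>\<omega>. of_bool (N \<omega> = n) :: real) \<in> borel_measurable ?F"
    by (rule measurable_compose[OF measurable_vimage_algebra1]) auto
  moreover have "(\<lambda>\<omega>. s ^ (\<Sum>i = 1..n. X i \<omega>)) \<in> borel_measurable ?G"
  proof -
    \<comment> \<open>The power depends on finitely many coordinates of the sequence, so it factors
      through the product space and is measurable for the pulled-back sigma-algebra.\<close>
    have "(\<lambda>x. s ^ (\<Sum>i = 1..n. x i)) \<in> borel_measurable ?P"
      by (rule measurable_compose[where N = "count_space UNIV"])
         (auto intro!: measurable_sum_nat measurable_component_singleton)
    then have "(\<lambda>\<omega>. (\<lambda>x. s ^ (\<Sum>i = 1..n. x i)) (\<lambda>i\<in>{1..}. X i \<omega>)) \<in> borel_measurable ?G"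
      by (rule measurable_compose[rotated, OF _ measurable_vimage_algebra1])
        (auto simp: space_PiM PiE_def extensional_def)
    then show ?thesis
      by simp
  qed
  moreover have "(\<lambda>\<omega>. s ^ (\<Sum>i = 1..n. X i \<omega>)) \<in> borel_measurable M"
    by (rule measurable_compose[where N = "count_space UNIV"])
       (use X in \<open>auto intro!: measurable_sum_nat\<close>)
  ultimately show ?thesis
    unfolding indep_var_eq indep_set_def
    by (intro conjI indep_sets_mono_sets[OF indep[unfolded indep_set_def]])
       (auto split: bool.split intro!: sub[THEN subsetD])
qed

text \<open>On the event \<open>N = n\<close> the sum has fixed length, and independence turns the
  contribution into the probability of that event times \<open>r ^ n\<close>; adding up gives the
  series of \<open>N\<close> at \<open>r\<close>. Asking only for a common value \<open>r\<close> at
  the given \<open>s\<close> lets the lemma serve both Bernoulli thinning and sums of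
  copies.\<close>

lemma pgf_random_sum:
  assumes indep: "indep_seq M X" "indep_of_seq M N X" and s: "s \<in> {0..1}"
    and pgf: "\<And>i. i \<ge> 1 \<Longrightarrow> pgf M (X i) s = r"
  shows "pgf M (random_sum N X) s = pgf M N r"
proof -
  have N[measurable]: "N \<in> M \<rightarrow>\<^sub>M count_space UNIV"
    and X: "\<And>i. i \<ge> 1 \<Longrightarrow> X i \<in> M \<rightarrow>\<^sub>M count_space UNIV"
    using indep(2) by (auto simp: indep_of_seq_def)
  have S: "random_sum N X \<in> M \<rightarrow>\<^sub>M count_space UNIV"
    using N X by (rule measurable_random_sum)
  have r: "r \<in> {0..1}"
    using pgf_nonneg_le_1[OF X[of 1] s] pgf[of 1] by simp
  have fibre: "(\<integral>\<omega>. of_bool (N \<omega> = n) * s ^ random_sum N X \<omega> \<partial>M)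
      = prob {\<omega> \<in> space M. N \<omega> = n} * r ^ n" for n
  proof -
    have S_n: "(\<lambda>\<omega>. \<Sum>i = 1..n. X i \<omega>) \<in> M \<rightarrow>\<^sub>M count_space UNIV"
      using X by (intro measurable_sum_nat) auto
    have "(\<integral>\<omega>. of_bool (N \<omega> = n) * s ^ random_sum N X \<omega> \<partial>M)
        = (\<integral>\<omega>. of_bool (N \<omega> = n) * s ^ (\<Sum>i = 1..n. X i \<omega>) \<partial>M)"
      \<comment> \<open>The two integrands agree where \<open>N \<omega> = n\<close> and both vanish
        elsewhere.\<close>
      by (rule Bochner_Integration.integral_cong) (auto simp: random_sum_def)
    also have "\<dots> = (\<integral>\<omega>. of_bool (N \<omega> = n) \<partial>M) * (\<integral>\<omega>. s ^ (\<Sum>i = 1..n. X i \<omega>) \<partial>M)"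
      by (rule indep_var_lebesgue_integral[OF indep_var_partial_sum[OF indep(2)] _
            integrable_power_le_1[OF S_n s]])
         (auto intro!: integrable_const_bound[where B = 1])
    also have "(\<integral>\<omega>. of_bool (N \<omega> = n) \<partial>M) = (\<integral>\<omega>. indicator {\<omega> \<in> space M. N \<omega> = n} \<omega> \<partial>M)"
      by (rule Bochner_Integration.integral_cong) (auto simp: indicator_def)
    also have "\<dots> = prob {\<omega> \<in> space M. N \<omega> = n}"
      by simp
    also have "(\<integral>\<omega>. s ^ (\<Sum>i = 1..n. X i \<omega>) \<partial>M) = r ^ n"
      using indep(1) s pgf by (rule integral_power_sum_indep)
    finally show ?thesis .
  qed
  have "(\<lambda>n. prob {\<omega> \<in> space M. N \<omega> = n} * r ^ n) sums pgf M (random_sum N X) s"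
    using integral_sums_fibres[OF N integrable_power_le_1[OF S s]] by (simp add: fibre pgf_def)
  then show ?thesis
    using pgf_sums[OF N r] by (rule sums_unique2)
qed

lemma pgf_random_sum_copies:
  assumes "indep_copies M Z X" "indep_of_seq M N X" and Z: "Z \<in> M \<rightarrow>\<^sub>M count_space UNIV"
    and s: "s \<in> {0..1}"
  shows "pgf M (random_sum N X) s = pgf M N (pgf M Z s)"
  using assms by (intro pgf_random_sum pgf_cong_law) (auto simp: indep_copies_def indep_of_seq_def)

lemma pgf_bernoulli:
  assumes "bernoulli_rv M b Y" "0 \<le> b" "b \<le> 1"
  shows "pgf M Y s = 1 - b + b * s"
proof -
  have [measurable]: "Y \<in> M \<rightarrow>\<^sub>M count_space UNIV"
    and law: "law M Y = measure_pmf (map_pmf of_bool (bernoulli_pmf b))"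
    using assms by (auto simp: bernoulli_rv_def)
  have "pgf M Y s = (\<integral>n. s ^ n \<partial>law M Y)"
    unfolding pgf_def law_def by (subst integral_distr) auto
  then show ?thesis
    unfolding law using assms by simp
qed

end

section \<open>Geometric compounding and the resulting functional equation\<close>

text \<open>The reciprocal of \<open>p * x / (1 - (1 - p) * x)\<close> is
  \<open>1 + (inverse x - 1) / p\<close>. In the coordinate \<open>inverse x - 1\<close>,
  compounding by a geometric variable is thus division by its parameter.\<close>

lemma geometric_pgf_eq_iff:
  fixes x y :: real
  assumes "0 < p" "p < 1" "0 < q" "q < 1" "0 < x" "x \<le> 1" "0 < y" "y \<le> 1"
  shows "p * x / (1 - (1 - p) * x) = q * y / (1 - (1 - q) * y)
    \<longleftrightarrow> inverse y - 1 = q / p * (inverse x - 1)"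
proof -
  have "(1 - p) * x < 1" "(1 - q) * y < 1"
    using assms by (smt (verit) mult_le_cancel_left1 mult_le_cancel_left2)+
  with assms show ?thesis
    by (simp add: field_simps)
qed

theorem theorem5p7:
  fixes \<Omega> :: "'a measure"
    and \<alpha> p p0 b lam :: real
    and M N N0 X :: "'a \<Rightarrow> nat"
    and Y Xs Ms :: "nat \<Rightarrow> 'a \<Rightarrow> nat"
  assumes "prob_space \<Omega>"
    and "0 < \<alpha>" "\<alpha> \<le> 1"
    and "0 < p" "p < 1" "0 < p0" "p0 < 1" "p0 \<noteq> p"
    and "0 < b" "b < 1"
    and "M \<in> \<Omega> \<rightarrow>\<^sub>M count_space UNIV"
    and "((\<lambda>s. (1 - pgf \<Omega> M s) / (1 - s) powr \<alpha>) \<longlongrightarrow> lam) (at_left 1)" "lam > 0"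
    and "indep_seq \<Omega> Y" "\<And>j. j \<ge> 1 \<Longrightarrow> bernoulli_rv \<Omega> b (Y j)"
    and "indep_of_seq \<Omega> M Y"
    and "X = random_sum M Y"
    and "indep_copies \<Omega> X Xs" "geometric_rv \<Omega> p N" "indep_of_seq \<Omega> N Xs"
    and "indep_copies \<Omega> M Ms" "geometric_rv \<Omega> p0 N0" "indep_of_seq \<Omega> N0 Ms"
  shows "law \<Omega> (random_sum N0 Ms) = law \<Omega> (random_sum N Xs) \<longleftrightarrow>
           p < p0 \<and> b powr \<alpha> = p / p0 \<and> DML_rv \<Omega> lam \<alpha> M"
proof -
  interpret prob_space \<Omega> by fact
  define P where "P = pgf \<Omega> M"
  \<comment> \<open>In this coordinate geometric summation divides by the parameter, thinning by
    \<open>b\<close> rescales \<open>t\<close>, and the discrete Mittag-Leffler law becomes the pure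
    power \<open>lam * t powr \<alpha>\<close>.\<close>
  define A where "A t = inverse (P (1 - t)) - 1" for t
  note meas_M = \<open>M \<in> \<Omega> \<rightarrow>\<^sub>M count_space UNIV\<close>
  have meas_X: "X \<in> \<Omega> \<rightarrow>\<^sub>M count_space UNIV"
    unfolding \<open>X = random_sum M Y\<close> using \<open>indep_of_seq \<Omega> M Y\<close>
    by (intro measurable_random_sum) (auto simp: indep_of_seq_def)
  have P_range: "P s \<in> {0..1}" if "s \<in> {0..1}" for s
    unfolding P_def using meas_M that by (rule pgf_nonneg_le_1)
  have P_pos: "0 < P s" if "0 < s" "s \<le> 1" for s
    unfolding P_def using meas_M that by (rule pgf_pos)
  have pgf_X: "pgf \<Omega> X s = P (1 - b + b * s)" if "s \<in> {0..1}" for s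
    unfolding \<open>X = random_sum M Y\<close> P_def
    using assms that by (intro pgf_random_sum pgf_bernoulli) auto
  \<comment> \<open>Strict positivity holds even at \<open>t = 1\<close> because
    \<open>b < 1\<close>, so \<open>P (1 - b * t)\<close> is positive also where
    \<open>P (1 - t)\<close> might vanish.\<close>
  have thinned: "0 < 1 - b * t" "1 - b * t \<le> 1" if "0 \<le> t" "t \<le> 1" for t
  proof -
    have "0 \<le> b * t" "b * t \<le> b"
      using that \<open>0 < b\<close> mult_left_mono[of t 1 b] by simp_all
    with \<open>b < 1\<close> show "0 < 1 - b * t" "1 - b * t \<le> 1"
      by linarith+
  qed
  have sum_M: "pgf \<Omega> (random_sum N0 Ms) s = p0 * P s / (1 - (1 - p0) * P s)"
    if "s \<in> {0..1}" for s
    using pgf_random_sum_copies[OF _ _ meas_M that, of Ms N0] P_range[OF that] assms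
    by (simp add: P_def geometric_rv_def)
  have sum_X: "pgf \<Omega> (random_sum N Xs) (1 - t) = p * P (1 - b * t) / (1 - (1 - p) * P (1 - b * t))"
    if "0 \<le> t" "t \<le> 1" for t
  proof -
    have "pgf \<Omega> X (1 - t) = P (1 - b * t)"
      using pgf_X[of "1 - t"] that by (simp add: algebra_simps)
    then show ?thesis
      using pgf_random_sum_copies[OF _ _ meas_X, of Xs N "1 - t"] P_range[of "1 - b * t"]
        thinned[OF that] that assms by (simp add: geometric_rv_def)
  qed
  have "law \<Omega> (random_sum N0 Ms) = law \<Omega> (random_sum N Xs) \<longleftrightarrow>
      (\<forall>s. 0 \<le> s \<longrightarrow> s < 1 \<longrightarrow> pgf \<Omega> (random_sum N0 Ms) s = pgf \<Omega> (random_sum N Xs) s)"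
    using assms by (intro law_eq_iff_pgf_eq measurable_random_sum) (auto simp: indep_of_seq_def)
  also have "\<dots> \<longleftrightarrow> (\<forall>t. 0 < t \<longrightarrow> t \<le> 1 \<longrightarrow>
      pgf \<Omega> (random_sum N0 Ms) (1 - t) = pgf \<Omega> (random_sum N Xs) (1 - t))" (is "_ \<longleftrightarrow> ?pgfs")
  proof
    assume H: ?pgfs
    show "\<forall>s. 0 \<le> s \<longrightarrow> s < 1 \<longrightarrow> pgf \<Omega> (random_sum N0 Ms) s = pgf \<Omega> (random_sum N Xs) s"
    proof (intro allI impI)
      fix s :: real assume "0 \<le> s" "s < 1"
      then show "pgf \<Omega> (random_sum N0 Ms) s = pgf \<Omega> (random_sum N Xs) s"
        using H[rule_format, of "1 - s"] by simp
    qed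
  qed simp
  \<comment> \<open>By the convention \<open>inverse 0 = 0\<close>, a zero of \<open>P\<close> would
    give \<open>A\<close> the value -1; the positivity conjunct records where \<open>A\<close> is
    built from a genuine reciprocal.\<close>
  also have "\<dots> \<longleftrightarrow> (\<forall>t. 0 < t \<longrightarrow> t \<le> 1 \<longrightarrow> 0 < P (1 - t) \<and> A (b * t) = p / p0 * A t)"
  proof -
    have "pgf \<Omega> (random_sum N0 Ms) (1 - t) = pgf \<Omega> (random_sum N Xs) (1 - t)
        \<longleftrightarrow> 0 < P (1 - t) \<and> A (b * t) = p / p0 * A t" if t: "0 < t" "t \<le> 1" for t
    proof (cases "0 < P (1 - t)")
      case True
      then show ?thesis
        using geometric_pgf_eq_iff[of p0 p "P (1 - t)" "P (1 - b * t)"] sum_M[of "1 - t"] sum_X[of t]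
          t thinned[of t] P_range[of "1 - t"] P_range[of "1 - b * t"] P_pos[of "1 - b * t"] assms
        by (simp add: A_def)
    next
      (* Only t = 1 can occur here, since P may vanish at 0 when M is almost surely positive. *)
      case False
      then have "P (1 - t) = 0"
        using P_range[of "1 - t"] t by auto
      moreover have "P (1 - b * t) > 0" "P (1 - b * t) \<le> 1"
        using P_pos[of "1 - b * t"] P_range[of "1 - b * t"] t thinned[of t] by auto
      moreover have "(1 - p) * P (1 - b * t) < 1"
        using calculation \<open>0 < p\<close> \<open>p < 1\<close> by (smt (verit) mult_le_cancel_left1 mult_le_cancel_left2)
      ultimately show ?thesis
        using sum_M[of "1 - t"] sum_X[of t] t \<open>0 < p\<close> by auto
    qed
    then show ?thesis by blast
  qed
  also have "\<dots> \<longleftrightarrow> p < p0 \<and> b powr \<alpha> = p / p0 \<and> DML_rv \<Omega> lam \<alpha> M"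
  proof
    assume *: "\<forall>t. 0 < t \<longrightarrow> t \<le> 1 \<longrightarrow> 0 < P (1 - t) \<and> A (b * t) = p / p0 * A t"
    have "filterlim (\<lambda>t. 1 - t) (at_left 1) (at_right (0 :: real))"
      by (auto simp: filterlim_at eventually_at_filter intro!: tendsto_eq_intros)
    from filterlim_compose[OF \<open>((\<lambda>s. (1 - pgf \<Omega> M s) / (1 - s) powr \<alpha>) \<longlongrightarrow> lam) (at_left 1)\<close> this]
    have lim_P: "((\<lambda>t. (1 - P (1 - t)) / t powr \<alpha>) \<longlongrightarrow> lam) (at_right 0)"
      by (simp add: P_def)
    have near_0: "eventually (\<lambda>t. 0 < t \<and> t < 1) (at_right (0 :: real))"
      using eventually_at_right_real[of "0::real" 1] by simp
    \<comment> \<open>Multiplying the convergent quotient back by \<open>t powr \<alpha>\<close>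
      shows that \<open>P (1 - t)\<close> tends to 1. As \<open>A t\<close> is
      \<open>(1 - P (1 - t)) / P (1 - t)\<close> near 0, it inherits the asymptotics of
      \<open>1 - P (1 - t)\<close>.\<close>
    have "((\<lambda>t. t powr \<alpha>) \<longlongrightarrow> 0) (at_right 0)"
      using \<open>0 < \<alpha>\<close> near_0 by (intro tendsto_zero_powrI[where b = \<alpha>]) (auto elim: eventually_mono)
    from tendsto_diff[OF tendsto_const[of 1] tendsto_mult[OF lim_P this]]
    have "((\<lambda>t. 1 - (1 - P (1 - t)) / t powr \<alpha> * t powr \<alpha>) \<longlongrightarrow> 1) (at_right 0)"
      by simp
    then have "((\<lambda>t. P (1 - t)) \<longlongrightarrow> 1) (at_right 0)"
      by (rule Lim_transform_eventually) (use near_0 in eventually_elim, simp)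
    from tendsto_divide[OF lim_P this]
    have "((\<lambda>t. (1 - P (1 - t)) / t powr \<alpha> / P (1 - t)) \<longlongrightarrow> lam) (at_right 0)"
      by simp
    then have "((\<lambda>t. A t / t powr \<alpha>) \<longlongrightarrow> lam) (at_right 0)"
    proof (rule Lim_transform_eventually)
      show "eventually (\<lambda>t. (1 - P (1 - t)) / t powr \<alpha> / P (1 - t) = A t / t powr \<alpha>) (at_right 0)"
        using near_0
      proof eventually_elim
        case (elim t)
        then show ?case
          using P_pos[of "1 - t"] by (simp add: A_def field_simps)
      qed
    qed
    moreover have "A (b * t) = p / p0 * A t" if "0 < t" "t \<le> 1" for t
      using * that by blast
    ultimately have c: "p / p0 = b powr \<alpha>" and A: "\<And>t. 0 < t \<Longrightarrow> t \<le> 1 \<Longrightarrow> A t = lam * t powr \<alpha>"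
      using scaling_equation_solution[of b A "p / p0" \<alpha> lam] \<open>0 < b\<close> \<open>b < 1\<close> \<open>lam > 0\<close>
      by blast+
    have "b powr \<alpha> < 1"
      using powr_less_mono2[of \<alpha> b 1] \<open>0 < \<alpha>\<close> \<open>0 < b\<close> \<open>b < 1\<close> by simp
    then have "p < p0"
      using c \<open>0 < p0\<close> by (simp add: field_simps)
    moreover have "P s = inverse (1 + lam * (1 - s) powr \<alpha>)" if "s \<in> {0..1}" for s
    \<comment> \<open>The point \<open>s = 1\<close> corresponds to \<open>t = 0\<close>, outside
      the range of the formula for \<open>A\<close>; both sides equal 1 there, since
      \<open>0 powr \<alpha>\<close> is 0.\<close>
    proof (cases "s = 1")
      case True
      then show ?thesis
        by (simp add: P_def pgf_at_1)
    next
      case False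
      with that have "inverse (P s) = 1 + lam * (1 - s) powr \<alpha>"
        using A[of "1 - s"] by (simp add: A_def)
      then show ?thesis
        by (metis inverse_inverse_eq)
    qed
    ultimately show "p < p0 \<and> b powr \<alpha> = p / p0 \<and> DML_rv \<Omega> lam \<alpha> M"
      using c meas_M \<open>0 < \<alpha>\<close> \<open>\<alpha> \<le> 1\<close> \<open>lam > 0\<close> by (simp add: DML_rv_def P_def)
  next
    assume R: "p < p0 \<and> b powr \<alpha> = p / p0 \<and> DML_rv \<Omega> lam \<alpha> M"
    have P: "P (1 - t) = inverse (1 + lam * t powr \<alpha>)" if "0 \<le> t" "t \<le> 1" for t
      using R that by (simp add: P_def DML_rv_def)
    show "\<forall>t. 0 < t \<longrightarrow> t \<le> 1 \<longrightarrow> 0 < P (1 - t) \<and> A (b * t) = p / p0 * A t"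
    proof (intro allI impI)
      fix t :: real assume t: "0 < t" "t \<le> 1"
      have "1 + lam * t powr \<alpha> > 0"
        using \<open>lam > 0\<close> by (simp add: add_pos_nonneg)
      \<comment> \<open>This permits the formula for \<open>P\<close> at \<open>b * t\<close> as
        well; \<open>powr_mult\<close> then splits off \<open>b powr \<alpha>\<close>, which is the
        required ratio \<open>p / p0\<close>.\<close>
      moreover have "b * t \<le> 1"
        using thinned[of t] t by simp
      ultimately show "0 < P (1 - t) \<and> A (b * t) = p / p0 * A t"
        using R P[of t] P[of "b * t"] t \<open>0 < b\<close> by (simp add: A_def powr_mult)
    qed
  qed
  finally show ?thesis .
qed

end
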